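(* Let $d\ge 1$ be the dimension, let $\bm a\in\mathbb R^d$ be a constant vector, and let $k,N\ge 0$ be integers. Let $u_h(t)\in\hat{\mathbf V}_N^k$ be the solution of the semi-discrete sparse grid discontinuous Galerkin scheme with upwind flux for $u_t+\nabla\cdot(\bm a\,u)=0$ on $\Omega=[0,1]^d$ with periodic boundary conditions, i.e. $$\int_\Omega (u_h)_t\,v_h\,d\mathbf x=\int_\Omega u_h\,\bm a\cdot\nabla v_h\,d\mathbf x-\sum_{e\in\Gamma}\int_e \widehat{\bm a u_h}\cdot[v_h]\,ds\qquad\text{for all } v_h\in\hat{\mathbf V}_N^k,$$ $$\widehat{\bm a u_h}=\bm a\{u_h\}+\frac{|\bm a\cdot\mathbf n|}{2}[u_h].$$ Then the scheme is $L^2$ stable, namely $$\frac12\frac{d}{dt}\int_\Omega (u_h)^2\,d\mathbf x=-\sum_{e\in\Gamma}\int_e\frac{|\bm a\cdot\mathbf n|}{2}\,|[u_h]|^2\,ds\le 0 .$$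
   Context: One-dimensional spaces: for $n\ge 0$, let $\Omega_n$ be the partition of $[0,1]$ into the $2^n$ cells $I_n^j=(2^{-n}j,2^{-n}(j+1)]$, $j=0,\dots,2^n-1$, and let $V_n^k$ be the space of functions whose restriction to each $I_n^j$ is a polynomial of degree at most $k$. Let $W_0^k=V_0^k$ and, for $n\ge1$, let $W_n^k$ be the $L^2(0,1)$-orthogonal complement of $V_{n-1}^k$ in $V_n^k$. Sparse space: for $\mathbf l=(l_1,\dots,l_d)\in\mathbb N_0^d$ put $|\mathbf l|_1=\sum_m l_m$ and let $\mathbf W_{\mathbf l}^k=W_{l_1,x_1}^k\times\cdots\times W_{l_d,x_d}^k$ be the tensor-product space (the factor $W^k_{l_m,x_m}$ acting in the variable $x_m$). The sparse finite element space is $\hat{\mathbf V}_N^k=\bigoplus_{|\mathbf l|_1\le N,\ \mathbf l\in\mathbb N_0^d}\mathbf W_{\mathbf l}^k$. Its elements are piecewise polynomials on the uniform Cartesian grid $\Omega_N$ of $[0,1]^d$ with cells of side length $2^{-N}$. Interfaces, jumps, averages: $\Gamma$ is the union (collection) of the interfaces (faces) $e$ of all cells of the $d$-dimensional grid $\Omega_N$, with opposite boundary faces of $[0,1]^d$ identified by periodicity. For a face $e$ shared by cells $T_+$ and $T_-$, $\mathbf n^\pm$ denotes the unit normal on $e$ pointing outward from $T_\pm$, $q^\pm$ the trace of $q$ from $T_\pm$, $[q]=q^-\mathbf n^-+q^+\mathbf n^+$ (a vector) and $\{q\}=\frac12(q^-+q^+)$. In $|\bm a\cdot\mathbf n|$,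 $\mathbf n$ is $\mathbf n^+$ or $\mathbf n^-$. Volume integrals involving $\nabla v_h$ are taken cell by cell. *)

theory Defs
  imports
    "HOL-Analysis.Analysis"
    "HOL-Computational_Algebra.Polynomial"
    "HOL-Library.Function_Algebras"
begin

text \<open>Real-valued functions with pointwise operations as a vector space (the library gives no
  \<open>real_vector\<close> instance for function types).\<close>

interpretation fun_vs: vector_space "\<lambda>(c::real) (f::'a \<Rightarrow> real) x. c * f x"
  by unfold_locales (auto simp: fun_eq_iff algebra_simps)


subsection \<open>The one-dimensional spaces\<close>

definition dyadic_cell :: "nat \<Rightarrow> nat \<Rightarrow> real set" where
  "dyadic_cell n j = {real j / 2 ^ n <.. (real j + 1) / 2 ^ n}"

text \<open>The cells cover \<open>{0<..1}\<close>.  Functions are total in HOL; members of the space are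
  extended by zero off \<open>{0<..1}\<close>, so that each is determined by its polynomial pieces.\<close>

definition dg_V :: "nat \<Rightarrow> nat \<Rightarrow> (real \<Rightarrow> real) set" where
  "dg_V k n = {f. (\<forall>j<2 ^ n. \<exists>p. degree p \<le> k \<and> (\<forall>x\<in>dyadic_cell n j. f x = poly p x)) \<and>
                  (\<forall>x. x \<notin> {0<..1} \<longrightarrow> f x = 0)}"

fun dg_W :: "nat \<Rightarrow> nat \<Rightarrow> (real \<Rightarrow> real) set" where
  "dg_W k 0 = dg_V k 0"
| "dg_W k (Suc n) =
     {f \<in> dg_V k (Suc n). \<forall>g\<in>dg_V k n. (LINT x:{0..1}|lborel. f x * g x) = 0}"


subsection \<open>The sparse space\<close>

definition tensor_W :: "nat \<Rightarrow> ('d::finite \<Rightarrow> nat) \<Rightarrow> (real ^ 'd \<Rightarrow> real) set" where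
  "tensor_W k l =
     fun_vs.span {(\<lambda>x. \<Prod>m\<in>UNIV. \<phi> m (x $ m)) | \<phi>. \<forall>m. \<phi> m \<in> dg_W k (l m)}"

text \<open>The sum of the subspaces \<open>tensor_W k l\<close> inside the space of all functions.  That the sum
  is direct is a property of these subspaces and does not enter the definition.\<close>

definition sparse_V :: "nat \<Rightarrow> nat \<Rightarrow> (real ^ 'd::finite \<Rightarrow> real) set" where
  "sparse_V k N = fun_vs.span (\<Union>l\<in>{l. (\<Sum>m\<in>UNIV. l m) \<le> N}. tensor_W k l)"


subsection \<open>The grid, its cells and its periodic faces\<close>

text \<open>Cells of side length \<open>1 / 2 ^ N\<close> are named by their multi-index.\<close>

definition grid_cells :: "nat \<Rightarrow> ('d::finite \<Rightarrow> nat) set" where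
  "grid_cells N = {c. \<forall>m. c m < 2 ^ N}"

definition open_cell :: "nat \<Rightarrow> ('d::finite \<Rightarrow> nat) \<Rightarrow> (real ^ 'd) set" where
  "open_cell N c = box (\<chi> m. real (c m) / 2 ^ N) (\<chi> m. (real (c m) + 1) / 2 ^ N)"

text \<open>The pair \<open>(i, c)\<close> names the face of cell \<open>c\<close> on which coordinate \<open>i\<close> is largest.
  Every face of the periodic grid is named exactly once: the upper boundary face of the
  unit cube in direction \<open>i\<close> also stands for the opposite lower boundary face.  On \<open>(i, c)\<close>,
  \<open>T\<^sub>-\<close> is the cell \<open>c\<close> and \<open>T\<^sub>+\<close> is its (periodic) neighbour in direction \<open>i\<close>; for
  \<open>N = 0\<close> both are the single cell, met from its two opposite sides.\<close>

type_synonym 'd face = "'d \<times> ('d \<Rightarrow> nat)"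

definition faces :: "nat \<Rightarrow> 'd::finite face set" where
  "faces N = UNIV \<times> grid_cells N"

fun cell_minus :: "nat \<Rightarrow> 'd::finite face \<Rightarrow> 'd \<Rightarrow> nat" where
  "cell_minus N (i, c) = c"

fun cell_plus :: "nat \<Rightarrow> 'd::finite face \<Rightarrow> 'd \<Rightarrow> nat" where
  "cell_plus N (i, c) = c(i := (c i + 1) mod 2 ^ N)"

fun normal_minus :: "'d::finite face \<Rightarrow> real ^ 'd" where
  "normal_minus (i, c) = axis i 1"

definition normal_plus :: "'d::finite face \<Rightarrow> real ^ 'd" where
  "normal_plus e = - normal_minus e"

text \<open>Points of the face \<open>(i, c)\<close> have \<open>i\<close>-th coordinate \<open>(c i + 1) / 2 ^ N\<close>.
  \<open>plus_point\<close> moves such a point to the corresponding one on the lower side of \<open>T\<^sub>+\<close>; it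
  differs from the given point only if the face lies on the boundary of the unit cube.\<close>

fun plus_point :: "nat \<Rightarrow> 'd::finite face \<Rightarrow> real ^ 'd \<Rightarrow> real ^ 'd" where
  "plus_point N (i, c) x =
     (\<chi> m. if m = i then real (cell_plus N (i, c) i) / 2 ^ N else x $ m)"

definition trace_minus :: "nat \<Rightarrow> 'd::finite face \<Rightarrow> (real ^ 'd \<Rightarrow> real) \<Rightarrow> real ^ 'd \<Rightarrow> real" where
  "trace_minus N e q x = Lim (at x within open_cell N (cell_minus N e)) q"

definition trace_plus :: "nat \<Rightarrow> 'd::finite face \<Rightarrow> (real ^ 'd \<Rightarrow> real) \<Rightarrow> real ^ 'd \<Rightarrow> real" where
  "trace_plus N e q x = Lim (at (plus_point N e x) within open_cell N (cell_plus N e)) q"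

definition jump :: "nat \<Rightarrow> 'd::finite face \<Rightarrow> (real ^ 'd \<Rightarrow> real) \<Rightarrow> real ^ 'd \<Rightarrow> real ^ 'd" where
  "jump N e q x =
     trace_minus N e q x *\<^sub>R normal_minus e + trace_plus N e q x *\<^sub>R normal_plus e"

definition average :: "nat \<Rightarrow> 'd::finite face \<Rightarrow> (real ^ 'd \<Rightarrow> real) \<Rightarrow> real ^ 'd \<Rightarrow> real" where
  "average N e q x = (trace_plus N e q x + trace_minus N e q x) / 2"

text \<open>The surface integral over the face \<open>(i, c)\<close>: the face is an axis-parallel piece of a
  hyperplane, so surface measure is the product Lebesgue measure in the coordinates other
  than \<open>i\<close>.  In dimension one this is the unit mass at the single point of the face.\<close>

fun face_integral :: "nat \<Rightarrow> 'd::finite face \<Rightarrow> (real ^ 'd \<Rightarrow> real) \<Rightarrow> real" where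
  "face_integral N (i, c) g =
     (LINT y:(\<Pi>\<^sub>E m\<in>UNIV - {i}. dyadic_cell N (c m))|(\<Pi>\<^sub>M m\<in>UNIV - {i}. lborel).
        g (\<chi> m. if m = i then (real (c i) + 1) / 2 ^ N else y m))"


subsection \<open>The semi-discrete scheme\<close>

definition grad :: "(real ^ 'd::finite \<Rightarrow> real) \<Rightarrow> real ^ 'd \<Rightarrow> real ^ 'd" where
  "grad v x = (\<chi> m. frechet_derivative v (at x) (axis m 1))"

definition upwind_flux ::
    "real ^ 'd::finite \<Rightarrow> nat \<Rightarrow> 'd face \<Rightarrow> (real ^ 'd \<Rightarrow> real) \<Rightarrow> real ^ 'd \<Rightarrow> real ^ 'd" where
  "upwind_flux a N e q x =
     average N e q x *\<^sub>R a + (\<bar>a \<bullet> normal_plus e\<bar> / 2) *\<^sub>R jump N e q x"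

text \<open>\<open>J\<close> is the time interval.  The time derivative \<open>ut\<close> is taken pointwise in space, which for
  curves in the finite-dimensional space \<open>sparse_V k N\<close> is differentiability of the
  coefficients with respect to any basis; at end points of \<open>J\<close> it is one-sided.\<close>

definition sparse_dg_solution ::
    "real ^ 'd::finite \<Rightarrow> nat \<Rightarrow> nat \<Rightarrow> real set \<Rightarrow> (real \<Rightarrow> real ^ 'd \<Rightarrow> real) \<Rightarrow> bool" where
  "sparse_dg_solution a k N J u \<longleftrightarrow>
     (\<forall>t\<in>J. u t \<in> sparse_V k N) \<and>
     (\<exists>ut. (\<forall>t\<in>J. \<forall>x. ((\<lambda>s. u s x) has_real_derivative ut t x) (at t within J)) \<and>
       (\<forall>t\<in>J. \<forall>v\<in>sparse_V k N.
          (LINT x:cbox 0 1|lborel. ut t x * v x) =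
          (\<Sum>c\<in>grid_cells N. LINT x:open_cell N c|lborel. u t x * (a \<bullet> grad v x)) -
          (\<Sum>e\<in>faces N. face_integral N e (\<lambda>x. upwind_flux a N e (u t) x \<bullet> jump N e v x))))"

end

theory Submission
  imports Defs
begin

text \<open>The scheme is tested with \<open>v = u t\<close>, which is admissible because \<open>u t\<close> lies in the
  sparse space.  The left-hand side is then half the time derivative of the energy
  (\<open>energy_has_derivative\<close>), so everything rests on evaluating the right-hand side on the diagonal,
  with both arguments equal to one function \<open>f\<close> (\<open>upwind_energy_identity\<close>).

  On a cell, \<open>f\<close> agrees with a polynomial \<open>F\<close>, and \<open>f (a \<bullet> \<nabla>f) = a \<bullet> \<nabla>(F\<^sup>2) / 2\<close>.  By the divergence
  theorem (\<open>cell_divergence\<close>) the volume term of the cell is the sum over the directions \<open>i\<close> of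
  \<open>a\<^sub>i / 2\<close> times the integral of \<open>F\<^sup>2\<close> over the upper face minus that over the lower face.  On a face
  orthogonal to direction \<open>i\<close> the averaged part of the flux contributes
  \<open>{f} a\<^sub>i (f\<^sup>- - f\<^sup>+) = a\<^sub>i / 2 ((f\<^sup>-)\<^sup>2 - (f\<^sup>+)\<^sup>2)\<close>.  By periodicity, moving to the next cell in
  direction \<open>i\<close> permutes the cells (\<open>cell_plus_bij\<close>), so each lower face of a cell is the plus
  side of exactly one face, and these contributions cancel the volume terms.  What is left
  is the penalty \<open>\<bar>a \<bullet> n\<bar> / 2 \<bar>[f]\<bar>\<^sup>2\<close> with a minus sign, and it is nonnegative pointwise.

  All integrals over cells and faces are computed for linear combinations of products
  \<open>\<Prod>\<^sub>m q\<^sub>m(x\<^sub>m)\<close> of polynomials in one variable (\<open>tensor_poly\<close>), where Fubini reduces them to products of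
  integrals over intervals and the divergence theorem to the fundamental theorem of calculus
  in one variable.

  The time derivative is given only pointwise in space.  It may be taken under the integral because
  interpolation at finitely many nodes \<open>z\<^sub>s\<close> reproduces the space (\<open>sparse_V_nodal\<close>): the energy is
  a fixed quadratic form in the finitely many differentiable numbers \<open>u t z\<^sub>s\<close>.\<close>

section \<open>Integrals of products over the coordinates\<close>

text \<open>The measure \<open>lborel\<close> on a Euclidean space is by construction the image of a product measure
  indexed by the standard basis; re-indexing the basis by the coordinates gives Fubini for
  functions that factor over the coordinates.\<close>

lemma lborel_prod_components:
  fixes h :: "'d::finite \<Rightarrow> real \<Rightarrow> real"
  assumes h: "\<And>m. integrable lborel (h m)"
  shows "integrable lborel (\<lambda>x::real ^ 'd. \<Prod>m\<in>UNIV. h m (x $ m))"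
    and "(LINT x|lborel. (\<Prod>m\<in>UNIV. h m ((x::real ^ 'd) $ m))) = (\<Prod>m\<in>UNIV. (LINT y|lborel. h m y))"
proof -
  let ?ax = "\<lambda>m::'d. axis m (1::real)"
  let ?ix = "the_inv ?ax"
  have inj: "inj ?ax"
    by (auto simp: inj_on_def axis_eq_axis)
  have basis: "(Basis :: (real ^ 'd) set) = range ?ax"
    by (auto simp: Basis_vec_def)
  have ix: "?ix (?ax m) = m" for m
    by (rule the_inv_f_f[OF inj])
  let ?T = "\<lambda>f. \<Sum>b\<in>(Basis :: (real ^ 'd) set). f b *\<^sub>R b"
  let ?P = "\<Pi>\<^sub>M b\<in>(Basis :: (real ^ 'd) set). (lborel :: real measure)"
  interpret P: product_sigma_finite "\<lambda>_::real ^ 'd. lborel :: real measure"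
    by unfold_locales
  have [measurable]: "h m \<in> borel_measurable borel" for m
    using h[of m] by auto
  have T: "?T \<in> measurable ?P borel"
    by measurable
  have comp: "?T f $ m = f (?ax m)" for f m
  proof -
    have "?T f $ m = ?T f \<bullet> ?ax m"
      by (simp add: cart_eq_inner_axis)
    also have "\<dots> = f (?ax m)"
      by (rule inner_sum_left_Basis) (simp add: basis)
    finally show ?thesis .
  qed
  have eq: "(\<Prod>m\<in>UNIV. h m (?T f $ m)) = (\<Prod>b\<in>Basis. h (?ix b) (f b))" for f
    unfolding comp by (simp add: basis prod.reindex[OF inj] ix)
  have meas: "(\<lambda>x::real ^ 'd. \<Prod>m\<in>UNIV. h m (x $ m)) \<in> borel_measurable borel"
    by measurable
  show "integrable lborel (\<lambda>x::real ^ 'd. \<Prod>m\<in>UNIV. h m (x $ m))"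
    unfolding lborel_eq[where 'a="real^'d"]
    by (subst integrable_distr_eq[OF T meas], unfold eq, rule P.product_integrable_prod) (auto simp: h)
  have "(LINT x|lborel. (\<Prod>m\<in>UNIV. h m ((x::real ^ 'd) $ m))) =
      (\<Prod>b\<in>(Basis :: (real ^ 'd) set). (LINT y|lborel. h (?ix b) y))"
    unfolding lborel_eq[where 'a="real^'d"]
    by (subst integral_distr[OF T meas], unfold eq, rule P.product_integral_prod) (auto simp: h)
  also have "\<dots> = (\<Prod>m\<in>UNIV. (LINT y|lborel. h m y))"
    unfolding basis by (simp add: prod.reindex[OF inj] ix)
  finally show "(LINT x|lborel. (\<Prod>m\<in>UNIV. h m ((x::real ^ 'd) $ m))) =
    (\<Prod>m\<in>UNIV. (LINT y|lborel. h m y))" .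
qed

lemma poly_integrable_Icc: "integrable lborel (\<lambda>x. indicator {l..r} x * poly q (x::real))"
proof -
  have "integrable lborel (\<lambda>x. poly q x * indicator {l..r} x)"
    by (rule borel_integrable_atLeastAtMost) auto
  then show ?thesis
    by (simp add: mult.commute)
qed

text \<open>Open, half-open and closed intervals occur together: volume integrals run over open cells, face
  integrals over products of half-open ones.  The end points form a null set, so closed intervals
  can serve as the common form.\<close>

lemma
  fixes l r :: real
  assumes A: "A \<in> sets borel" "{l<..<r} \<subseteq> A" "A \<subseteq> {l..r}"
  shows poly_integrable_interval: "integrable lborel (\<lambda>x. indicator A x * poly q x)"
    and poly_integral_interval:
      "(LINT x|lborel. indicator A x * poly q x) = (LINT x|lborel. indicator {l..r} x * poly q x)"
proof -
  have "integrable lborel (\<lambda>x. indicator A x *\<^sub>R (indicator {l..r} x * poly q x))"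
    using A by (intro integrable_mult_indicator poly_integrable_Icc) auto
  moreover have "indicator A x *\<^sub>R (indicator {l..r} x * poly q x) = indicator A x * poly q x" for x
    using A by (auto simp: indicator_def)
  ultimately show int: "integrable lborel (\<lambda>x. indicator A x * poly q x)"
    by (simp only:)
  have "AE x in lborel. x \<noteq> l" "AE x in lborel. x \<noteq> r"
    by (rule AE_lborel_singleton)+
  then have "AE x in lborel. indicator A x * poly q x = indicator {l..r} x * poly q x"
  proof eventually_elim
    case (elim x)
    then have "x \<in> {l..r} \<Longrightarrow> x \<in> {l<..<r}"
      by auto
    with A(2,3) have "x \<in> A \<longleftrightarrow> x \<in> {l..r}"
      by blast
    then show ?case by (simp add: indicator_def)
  qed
  then show "(LINT x|lborel. indicator A x * poly q x) = (LINT x|lborel. indicator {l..r} x * poly q x)"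
    using int poly_integrable_Icc by (intro integral_cong_AE borel_measurable_integrable)
qed

lemma poly_integral_pderiv:
  assumes "l \<le> r"
  shows "(LINT x|lborel. indicator {l..r} x * poly (pderiv q) x) = poly q r - poly q (l::real)"
proof -
  have "(LINT x|lborel. poly (pderiv q) x * indicator {l..r} x) = poly q r - poly q l"
    using assms by (intro integral_FTC_Icc_real) (auto intro: poly_DERIV)
  then show ?thesis
    by (simp add: mult.commute)
qed

section \<open>Polynomials as combinations of coordinatewise products\<close>

text \<open>This is the algebra of all polynomial functions in the coordinates.  Spanning it by
  coordinatewise products is what makes Fubini applicable to each spanning element.\<close>

definition tensor_poly :: "(real ^ 'd::finite \<Rightarrow> real) set" where
  "tensor_poly = fun_vs.span {(\<lambda>x. \<Prod>m\<in>UNIV. poly (q m) (x $ m)) | q. True}"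

lemma tensor_poly_prod: "(\<lambda>x. \<Prod>m\<in>UNIV. poly (q m) (x $ m)) \<in> tensor_poly"
  unfolding tensor_poly_def by (rule fun_vs.span_base) blast

lemma tensor_poly_0: "(\<lambda>x. 0) \<in> tensor_poly"
  using fun_vs.span_zero unfolding tensor_poly_def zero_fun_def .

lemma tensor_poly_add:
  "F \<in> tensor_poly \<Longrightarrow> G \<in> tensor_poly \<Longrightarrow> (\<lambda>x. F x + G x) \<in> tensor_poly"
  using fun_vs.span_add unfolding tensor_poly_def plus_fun_def .

lemma tensor_poly_scale: "F \<in> tensor_poly \<Longrightarrow> (\<lambda>x. c * F x) \<in> tensor_poly"
  unfolding tensor_poly_def by (rule fun_vs.span_scale)

lemma tensor_poly_diff:
  "F \<in> tensor_poly \<Longrightarrow> G \<in> tensor_poly \<Longrightarrow> (\<lambda>x. F x - G x) \<in> tensor_poly"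
  using fun_vs.span_diff unfolding tensor_poly_def fun_diff_def .

lemma tensor_poly_induct [consumes 1, case_names zero add scale prod]:
  assumes "F \<in> tensor_poly"
    and zero: "P (\<lambda>x. 0)"
    and add: "\<And>F G. F \<in> tensor_poly \<Longrightarrow> G \<in> tensor_poly \<Longrightarrow> P F \<Longrightarrow> P G \<Longrightarrow> P (\<lambda>x. F x + G x)"
    and scale: "\<And>c F. F \<in> tensor_poly \<Longrightarrow> P F \<Longrightarrow> P (\<lambda>x. c * F x)"
    and prod: "\<And>q. P (\<lambda>x. \<Prod>m\<in>UNIV. poly (q m) (x $ m))"
  shows "P F"
proof -
  let ?S = "{F \<in> tensor_poly. P F}"
  have "F \<in> ?S"
    using \<open>F \<in> tensor_poly\<close>[unfolded tensor_poly_def]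
  proof (rule fun_vs.span_induct)
    show "fun_vs.subspace {x. x \<in> ?S}"
      unfolding fun_vs.subspace_def
      using zero add scale tensor_poly_0 tensor_poly_add tensor_poly_scale
      by (auto simp: zero_fun_def plus_fun_def)
  next
    fix G :: "real ^ 'a \<Rightarrow> real"
    assume "G \<in> {(\<lambda>x. \<Prod>m\<in>UNIV. poly (q m) (x $ m)) | q. True}"
    then show "G \<in> ?S"
      using tensor_poly_prod prod by auto
  qed
  then show ?thesis
    by simp
qed

lemma tensor_poly_mult:
  assumes "F \<in> tensor_poly" "G \<in> tensor_poly"
  shows "(\<lambda>x. F x * G x) \<in> tensor_poly"
  using assms(1)
proof (induction F rule: tensor_poly_induct)
  case zero
  show ?case by (simp add: tensor_poly_0)
next
  case (add F H)
  then show ?case using tensor_poly_add[OF add.IH] by (simp add: distrib_right)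
next
  case (scale c F)
  then show ?case using tensor_poly_scale[OF scale.IH, of c] by (simp add: mult.assoc)
next
  case (prod q)
  show ?case
    using assms(2)
  proof (induction G rule: tensor_poly_induct)
    case zero
    show ?case by (simp add: tensor_poly_0)
  next
    case (add F H)
    then show ?case using tensor_poly_add[OF add.IH] by (simp add: distrib_left)
  next
    case (scale c F)
    then show ?case using tensor_poly_scale[OF scale.IH, of c] by (simp add: mult.left_commute)
  next
    case (prod q')
    show ?case
      using tensor_poly_prod[of "\<lambda>m. q m * q' m"] by (simp add: prod.distrib)
  qed
qed

text \<open>Restricting a polynomial to a hyperplane \<open>x\<^sub>i = r\<close> and extending it constantly in
  direction \<open>i\<close> gives a polynomial again.  Traces from the two sides of a face live on different
  hyperplanes when the face is periodic; after freezing they can be subtracted and multiplied as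
  functions on one space.\<close>

lemma tensor_poly_freeze:
  assumes "F \<in> tensor_poly"
  shows "(\<lambda>x. F (\<chi> m. if m = i then r else x $ m)) \<in> tensor_poly"
  using assms
proof (induction F rule: tensor_poly_induct)
  case zero
  show ?case by (rule tensor_poly_0)
next
  case (add F H)
  then show ?case using tensor_poly_add[OF add.IH] by simp
next
  case (scale c F)
  then show ?case using tensor_poly_scale[OF scale.IH, of c] by simp
next
  case (prod q)
  have "(\<lambda>x. \<Prod>m\<in>UNIV. poly (q m) ((\<chi> m. if m = i then r else x $ m) $ m)) =
    (\<lambda>x. \<Prod>m\<in>UNIV. poly (if m = i then [:poly (q i) r:] else q m) (x $ m))"
    by (intro ext prod.cong) auto
  then show ?case
    by (simp only: tensor_poly_prod)
qed

lemma has_derivative_tensor_prod: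
  fixes q :: "'d::finite \<Rightarrow> real poly"
  shows "((\<lambda>x. \<Prod>m\<in>UNIV. poly (q m) (x $ m)) has_derivative
    (\<lambda>h. \<Sum>i\<in>UNIV. h $ i * (\<Prod>m\<in>UNIV. poly ((q(i := pderiv (q i))) m) (x $ m)))) (at x)"
proof -
  have "((\<lambda>x. poly (q m) (x $ m)) has_derivative (\<lambda>h. poly (pderiv (q m)) (x $ m) * h $ m)) (at x)" for m
    using has_derivative_compose[OF bounded_linear_imp_has_derivative[OF bounded_linear_vec_nth[of m]]
        poly_DERIV[of "q m" "x $ m", unfolded has_field_derivative_def]] .
  then have "((\<lambda>x. \<Prod>m\<in>UNIV. poly (q m) (x $ m)) has_derivative
      (\<lambda>h. \<Sum>i\<in>UNIV. (poly (pderiv (q i)) (x $ i) * h $ i) * (\<Prod>m\<in>UNIV - {i}. poly (q m) (x $ m)))) (at x)"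
    by (rule has_derivative_prod)
  moreover have "(\<Prod>m\<in>UNIV. poly ((q(i := pderiv (q i))) m) (x $ m)) =
      poly (pderiv (q i)) (x $ i) * (\<Prod>m\<in>UNIV - {i}. poly (q m) (x $ m))" for i
    by (subst prod.remove[of _ i]) auto
  ultimately show ?thesis
    by (simp add: mult_ac)
qed

lemma grad_prod:
  "grad (\<lambda>x. \<Prod>m\<in>UNIV. poly (q m) (x $ m)) x $ i =
    (\<Prod>m\<in>UNIV. poly ((q(i := pderiv (q i))) m) (x $ m))"
  using frechet_derivative_at[OF has_derivative_tensor_prod, symmetric, of q x]
  by (simp add: grad_def axis_def if_distrib[of "\<lambda>z. z * _"] cong: if_cong)

lemma tensor_poly_differentiable: "F \<in> tensor_poly \<Longrightarrow> F differentiable (at x)"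
proof (induction F rule: tensor_poly_induct)
  case (prod q)
  show ?case
    using has_derivative_tensor_prod by (auto simp: differentiable_def)
qed (simp_all add: differentiable_add differentiable_mult)

lemma grad_add:
  assumes "F differentiable (at x)" "G differentiable (at x)"
  shows "grad (\<lambda>x. F x + G x) x = grad F x + grad G x"
  using frechet_derivative_at[OF has_derivative_add[OF assms[unfolded frechet_derivative_works]], symmetric]
  by (simp add: grad_def vec_eq_iff)

lemma grad_mult:
  fixes F G :: "real ^ 'd::finite \<Rightarrow> real"
  assumes "F differentiable (at x)" "G differentiable (at x)"
  shows "grad (\<lambda>x. F x * G x) x = F x *\<^sub>R grad G x + G x *\<^sub>R grad F x"
  using frechet_derivative_at[OF has_derivative_mult[OF assms[unfolded frechet_derivative_works]], symmetric]
  by (simp add: grad_def vec_eq_iff mult.commute)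

lemma grad_const: "grad (\<lambda>x. c) x = 0"
  by (simp add: grad_def vec_eq_iff)

lemma grad_tensor_poly: "F \<in> tensor_poly \<Longrightarrow> (\<lambda>x. grad F x $ i) \<in> tensor_poly"
proof (induction F rule: tensor_poly_induct)
  case zero
  show ?case by (simp add: grad_const tensor_poly_0)
next
  case (add F G)
  then show ?case
    by (simp add: grad_add tensor_poly_differentiable tensor_poly_add)
next
  case (scale c F)
  then show ?case
    by (simp add: grad_mult grad_const tensor_poly_differentiable tensor_poly_scale)
next
  case (prod q)
  show ?case
    unfolding grad_prod by (rule tensor_poly_prod)
qed

section \<open>The divergence theorem on a grid cell\<close>

text \<open>The surface integral over the section of the cell by the hyperplane \<open>x\<^sub>i = r\<close>.  With \<open>r\<close> the
  upper end of the cell it is \<open>face_integral\<close>; the free parameter also covers the lower face.\<close>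

definition slice_integral :: "nat \<Rightarrow> 'd::finite \<Rightarrow> ('d \<Rightarrow> nat) \<Rightarrow> real \<Rightarrow> (real ^ 'd \<Rightarrow> real) \<Rightarrow> real" where
  "slice_integral N i c r g =
     (LINT y:(\<Pi>\<^sub>E m\<in>UNIV - {i}. dyadic_cell N (c m))|(\<Pi>\<^sub>M m\<in>UNIV - {i}. lborel).
        g (\<chi> m. if m = i then r else y m))"

lemma prod_indicator:
  "finite I \<Longrightarrow> (\<Prod>m\<in>I. indicator (A m) (y m)) = (of_bool (\<forall>m\<in>I. y m \<in> A m) :: real)"
  by (induction I rule: finite_induct) auto

lemma indicator_open_cell:
  "indicator (open_cell N c) x =
    (\<Prod>m\<in>UNIV. indicator {real (c m) / 2 ^ N<..<(real (c m) + 1) / 2 ^ N} (x $ m) :: real)"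
  by (simp add: prod_indicator open_cell_def mem_box_cart indicator_def)

lemma open_cell_measurable [measurable]: "open_cell N c \<in> sets borel"
  by (simp add: open_cell_def)

lemma
  fixes c :: "'d::finite \<Rightarrow> nat" and q :: "'d \<Rightarrow> real poly"
  shows open_cell_integrable_prod:
      "set_integrable lborel (open_cell N c) (\<lambda>x. \<Prod>m\<in>UNIV. poly (q m) (x $ m))"
    and open_cell_integral_prod:
      "(LINT x:open_cell N c|lborel. (\<Prod>m\<in>UNIV. poly (q m) (x $ m))) =
        (\<Prod>m\<in>UNIV. (LINT t|lborel.
          indicator {real (c m) / 2 ^ N..(real (c m) + 1) / 2 ^ N} t * poly (q m) t))"
proof -
  let ?h = "\<lambda>m t. indicator {real (c m) / 2 ^ N<..<(real (c m) + 1) / 2 ^ N} t * poly (q m) t"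
  have eq: "indicator (open_cell N c) x *\<^sub>R (\<Prod>m\<in>UNIV. poly (q m) (x $ m)) = (\<Prod>m\<in>UNIV. ?h m (x $ m))" for x
    by (simp add: indicator_open_cell prod.distrib)
  have h: "integrable lborel (?h m)" for m
    by (rule poly_integrable_interval) auto
  show "set_integrable lborel (open_cell N c) (\<lambda>x. \<Prod>m\<in>UNIV. poly (q m) (x $ m))"
    unfolding set_integrable_def eq by (rule lborel_prod_components(1)[OF h])
  have "(LINT t|lborel. ?h m t) = (LINT t|lborel.
      indicator {real (c m) / 2 ^ N..(real (c m) + 1) / 2 ^ N} t * poly (q m) t)" for m
    by (rule poly_integral_interval) auto
  then show "(LINT x:open_cell N c|lborel. (\<Prod>m\<in>UNIV. poly (q m) (x $ m))) =
        (\<Prod>m\<in>UNIV. (LINT t|lborel.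
          indicator {real (c m) / 2 ^ N..(real (c m) + 1) / 2 ^ N} t * poly (q m) t))"
    unfolding set_lebesgue_integral_def eq by (simp add: lborel_prod_components(2)[OF h])
qed

lemma
  fixes c :: "'d::finite \<Rightarrow> nat" and q :: "'d \<Rightarrow> real poly"
  shows slice_integrable_prod:
      "set_integrable (\<Pi>\<^sub>M m\<in>UNIV - {i}. lborel) (\<Pi>\<^sub>E m\<in>UNIV - {i}. dyadic_cell N (c m))
        (\<lambda>y. \<Prod>m\<in>UNIV. poly (q m) ((\<chi> m. if m = i then r else y m) $ m))"
    and slice_integral_prod:
      "slice_integral N i c r (\<lambda>x. \<Prod>m\<in>UNIV. poly (q m) (x $ m)) =
        poly (q i) r * (\<Prod>m\<in>UNIV - {i}. (LINT t|lborel.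
          indicator {real (c m) / 2 ^ N..(real (c m) + 1) / 2 ^ N} t * poly (q m) t))"
proof -
  let ?M = "\<Pi>\<^sub>M m\<in>UNIV - {i}. (lborel :: real measure)"
  let ?E = "\<Pi>\<^sub>E m\<in>UNIV - {i}. dyadic_cell N (c m)"
  let ?h = "\<lambda>m t. indicator (dyadic_cell N (c m)) t * poly (q m) t"
  interpret P: product_sigma_finite "\<lambda>_::'d. lborel :: real measure"
    by unfold_locales
  have eq: "indicator ?E y *\<^sub>R (\<Prod>m\<in>UNIV. poly (q m) ((\<chi> m. if m = i then r else y m) $ m)) =
      poly (q i) r * (\<Prod>m\<in>UNIV - {i}. ?h m (y m))" if "y \<in> space ?M" for y
  proof -
    have "y \<in> extensional (UNIV - {i})"
      using that by (simp add: space_PiM PiE_def)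
    then have "indicator ?E y = (of_bool (\<forall>m\<in>UNIV - {i}. y m \<in> dyadic_cell N (c m)) :: real)"
      by (auto simp: indicator_def PiE_def)
    moreover have "(\<Prod>m\<in>UNIV. poly (q m) ((\<chi> m. if m = i then r else y m) $ m)) =
        poly (q i) r * (\<Prod>m\<in>UNIV - {i}. poly (q m) (y m))"
      by (subst prod.remove[of _ i]) auto
    ultimately show ?thesis
      by (simp add: prod.distrib prod_indicator)
  qed
  have h: "integrable lborel (?h m)" for m
    by (rule poly_integrable_interval) (auto simp: dyadic_cell_def intro: less_imp_le)
  show "set_integrable ?M ?E (\<lambda>y. \<Prod>m\<in>UNIV. poly (q m) ((\<chi> m. if m = i then r else y m) $ m))"
    unfolding set_integrable_def
    by (subst Bochner_Integration.integrable_cong[OF refl eq], assumption)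
      (intro integrable_mult_right P.product_integrable_prod h; simp)
  have "(LINT t|lborel. ?h m t) = (LINT t|lborel.
      indicator {real (c m) / 2 ^ N..(real (c m) + 1) / 2 ^ N} t * poly (q m) t)" for m
    by (rule poly_integral_interval) (auto simp: dyadic_cell_def intro: less_imp_le)
  moreover have "(LINT y|?M. (\<Prod>m\<in>UNIV - {i}. ?h m (y m))) = (\<Prod>m\<in>UNIV - {i}. (LINT t|lborel. ?h m t))"
    by (rule P.product_integral_prod) (auto simp: h)
  moreover have "slice_integral N i c r (\<lambda>x. \<Prod>m\<in>UNIV. poly (q m) (x $ m)) =
      (LINT y|?M. poly (q i) r * (\<Prod>m\<in>UNIV - {i}. ?h m (y m)))"
    unfolding slice_integral_def set_lebesgue_integral_def
    by (rule Bochner_Integration.integral_cong[OF refl eq])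
  ultimately show "slice_integral N i c r (\<lambda>x. \<Prod>m\<in>UNIV. poly (q m) (x $ m)) =
        poly (q i) r * (\<Prod>m\<in>UNIV - {i}. (LINT t|lborel.
          indicator {real (c m) / 2 ^ N..(real (c m) + 1) / 2 ^ N} t * poly (q m) t))"
    by simp
qed

lemma open_cell_integrable: "F \<in> tensor_poly \<Longrightarrow> set_integrable lborel (open_cell N c) F"
proof (induction F rule: tensor_poly_induct)
  case zero
  show ?case by (simp add: set_integrable_def)
qed (auto intro: open_cell_integrable_prod)

lemma slice_integrable:
  "F \<in> tensor_poly \<Longrightarrow>
    set_integrable (\<Pi>\<^sub>M m\<in>UNIV - {i}. lborel) (\<Pi>\<^sub>E m\<in>UNIV - {i}. dyadic_cell N (c m))
      (\<lambda>y. F (\<chi> m. if m = i then r else y m))"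
proof (induction F rule: tensor_poly_induct)
  case zero
  show ?case by (simp add: set_integrable_def)
next
  case (prod q)
  show ?case by (rule slice_integrable_prod)
qed auto

lemma slice_integral_add:
  "F \<in> tensor_poly \<Longrightarrow> G \<in> tensor_poly \<Longrightarrow>
    slice_integral N i c r (\<lambda>x. F x + G x) = slice_integral N i c r F + slice_integral N i c r G"
  unfolding slice_integral_def by (intro set_integral_add slice_integrable)

lemma slice_integral_scale: "slice_integral N i c r (\<lambda>x. b * F x) = b * slice_integral N i c r F"
  unfolding slice_integral_def by (rule set_integral_mult_right)

text \<open>A section orthogonal to direction \<open>i\<close> depends only on the other entries of the multi-index, so
  neighbours in direction \<open>i\<close> have the same sections.\<close>

lemma slice_integral_upd: "slice_integral N i (c(i := j)) r F = slice_integral N i c r F"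
proof -
  have "(\<Pi>\<^sub>E m\<in>UNIV - {i}. dyadic_cell N ((c(i := j)) m)) = (\<Pi>\<^sub>E m\<in>UNIV - {i}. dyadic_cell N (c m))"
    by (rule PiE_cong) auto
  then show ?thesis
    by (simp add: slice_integral_def)
qed

text \<open>Both sides are linear in \<open>F\<close>.  For a product \<open>\<Prod>\<^sub>m q\<^sub>m(x\<^sub>m)\<close> the derivative in direction \<open>i\<close> only replaces
  \<open>q\<^sub>i\<close> by its derivative, whose integral over the edge is the difference of the end values; the
  remaining factors integrate to the same constant on the cell and on its two faces.\<close>

lemma cell_divergence:
  assumes "F \<in> tensor_poly"
  shows "(LINT x:open_cell N c|lborel. grad F x $ i) =
    slice_integral N i c ((real (c i) + 1) / 2 ^ N) F - slice_integral N i c (real (c i) / 2 ^ N) F"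
  using assms
proof (induction F rule: tensor_poly_induct)
  case zero
  show ?case
    by (simp add: grad_const slice_integral_def set_lebesgue_integral_def)
next
  case (add F G)
  then show ?case
    by (simp add: grad_add tensor_poly_differentiable slice_integral_add
        set_integral_add(2)[OF open_cell_integrable open_cell_integrable] grad_tensor_poly)
next
  case (scale b F)
  then show ?case
    by (simp add: grad_mult grad_const tensor_poly_differentiable slice_integral_scale right_diff_distrib)
next
  case (prod q)
  let ?I = "\<lambda>q m. LINT t|lborel. indicator {real (c m) / 2 ^ N..(real (c m) + 1) / 2 ^ N} t * poly (q m) t"
  have "(LINT x:open_cell N c|lborel. grad (\<lambda>x. \<Prod>m\<in>UNIV. poly (q m) (x $ m)) x $ i) =
      (\<Prod>m\<in>UNIV. ?I (q(i := pderiv (q i))) m)"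
    unfolding grad_prod by (rule open_cell_integral_prod)
  also have "\<dots> = ?I (\<lambda>m. pderiv (q m)) i * (\<Prod>m\<in>UNIV - {i}. ?I q m)"
    by (subst prod.remove[of _ i]) auto
  also have "?I (\<lambda>m. pderiv (q m)) i = poly (q i) ((real (c i) + 1) / 2 ^ N) - poly (q i) (real (c i) / 2 ^ N)"
    by (rule poly_integral_pderiv) (simp add: divide_right_mono)
  finally show ?case
    by (simp add: slice_integral_prod left_diff_distrib)
qed

section \<open>Traces and the upwind energy identity\<close>

lemma open_open_cell: "open (open_cell N c)"
  unfolding open_cell_def by (rule open_box)

text \<open>The traces are limits from within an open cell.  At any point of the closed cell the limit
  exists and is the value of the polynomial that represents the function on that cell.\<close>

lemma Lim_open_cell:
  assumes F: "F \<in> tensor_poly" and f: "\<And>x. x \<in> open_cell N c \<Longrightarrow> f x = F x"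
    and x: "\<And>m. real (c m) / 2 ^ N \<le> x $ m" "\<And>m. x $ m \<le> (real (c m) + 1) / 2 ^ N"
  shows "Lim (at x within open_cell N c) f = F x"
proof (rule tendsto_Lim)
  let ?lo = "\<chi> m. real (c m) / 2 ^ N" and ?hi = "\<chi> m. (real (c m) + 1) / 2 ^ N"
  have "box ?lo ?hi \<noteq> {}"
    by (auto simp: interval_ne_empty_cart divide_strict_right_mono)
  then have "closure (open_cell N c) = cbox ?lo ?hi"
    by (simp add: open_cell_def closure_box)
  then have "x \<in> closure (open_cell N c)"
    using x by (simp add: mem_box_cart)
  then have "x islimpt open_cell N c"
    using interior_limit_point interior_open[OF open_open_cell] unfolding closure_def by blast
  then show "at x within open_cell N c \<noteq> bot"
    by (simp add: trivial_limit_within)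
  have "isCont F x"
    using tensor_poly_differentiable[OF F] by (rule differentiable_imp_continuous_within)
  then have "(F \<longlongrightarrow> F x) (at x within open_cell N c)"
    unfolding isCont_def by (rule tendsto_within_subset) simp
  moreover have "\<forall>\<^sub>F y in at x within open_cell N c. f y = F y"
    by (simp add: eventually_at_filter f)
  ultimately show "(f \<longlongrightarrow> F x) (at x within open_cell N c)"
    using tendsto_cong by blast
qed

lemma trace_minus_eq:
  assumes "F \<in> tensor_poly" "\<And>x. x \<in> open_cell N c \<Longrightarrow> f x = F x"
    and y: "y \<in> (\<Pi>\<^sub>E m\<in>UNIV - {i}. dyadic_cell N (c m))"
  defines "x \<equiv> \<chi> m. if m = i then (real (c i) + 1) / 2 ^ N else y m"
  shows "trace_minus N (i, c) f x = F x"
proof -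
  have "y m \<in> dyadic_cell N (c m)" if "m \<noteq> i" for m
    using y that by auto
  then have "real (c m) / 2 ^ N \<le> x $ m \<and> x $ m \<le> (real (c m) + 1) / 2 ^ N" for m
    by (cases "m = i") (auto simp: x_def dyadic_cell_def divide_right_mono intro: less_imp_le)
  then show ?thesis
    unfolding trace_minus_def using assms(1,2) by (simp add: Lim_open_cell)
qed

text \<open>The neighbouring cell contributes its own polynomial at its own lower end.  On an interior face
  this is the face itself; on a boundary face it is the opposite face, reached by periodicity.\<close>

lemma trace_plus_eq:
  fixes N :: nat and i :: "'d::finite" and c :: "'d \<Rightarrow> nat"
  defines "c' \<equiv> cell_plus N (i, c)"
  assumes "F \<in> tensor_poly" "\<And>x. x \<in> open_cell N c' \<Longrightarrow> f x = F x"
    and y: "y \<in> (\<Pi>\<^sub>E m\<in>UNIV - {i}. dyadic_cell N (c m))"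
  shows "trace_plus N (i, c) f (\<chi> m. if m = i then r else y m) =
    F (\<chi> m. if m = i then real (c' i) / 2 ^ N else y m)"
proof -
  let ?x = "\<chi> m. if m = i then real (c' i) / 2 ^ N else y m"
  have pp: "plus_point N (i, c) (\<chi> m. if m = i then r else y m) = ?x"
    by (simp add: vec_eq_iff c'_def)
  have "y m \<in> dyadic_cell N (c m)" "c' m = c m" if "m \<noteq> i" for m
    using y that by (auto simp: c'_def)
  then have "real (c' m) / 2 ^ N \<le> ?x $ m \<and> ?x $ m \<le> (real (c' m) + 1) / 2 ^ N" for m
    by (cases "m = i") (auto simp: dyadic_cell_def divide_right_mono intro: less_imp_le)
  then show ?thesis
    unfolding trace_plus_def pp c'_def[symmetric] using assms(2,3) by (simp add: Lim_open_cell)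
qed

text \<open>Since \<open>F \<partial>\<^sub>iF = \<partial>\<^sub>i(F\<^sup>2) / 2\<close>, the volume term is a combination of integrals of partial derivatives,
  to which the divergence theorem applies.\<close>

lemma volume_term:
  assumes F: "F \<in> tensor_poly" and f: "\<And>x. x \<in> open_cell N c \<Longrightarrow> f x = F x"
  shows "(LINT x:open_cell N c|lborel. f x * (a \<bullet> grad f x)) =
    (\<Sum>i\<in>UNIV. a $ i / 2 *
      (slice_integral N i c ((real (c i) + 1) / 2 ^ N) (\<lambda>x. F x * F x) -
       slice_integral N i c (real (c i) / 2 ^ N) (\<lambda>x. F x * F x)))"
proof -
  let ?G = "\<lambda>x. F x * F x"
  have G: "?G \<in> tensor_poly"
    by (intro tensor_poly_mult F)
  have "f x * (a \<bullet> grad f x) = (\<Sum>i\<in>UNIV. a $ i / 2 * grad ?G x $ i)" if x: "x \<in> open_cell N c" for x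
  proof -
    have "frechet_derivative F (at x) = frechet_derivative f (at x)"
      by (rule frechet_derivative_transform_within_open[OF tensor_poly_differentiable[OF F] open_open_cell x])
        (simp add: f)
    then have "grad f x = grad F x"
      by (simp add: grad_def)
    then show ?thesis
      using x by (simp add: f grad_mult tensor_poly_differentiable[OF F] inner_vec_def sum_distrib_left mult_ac)
  qed
  then have "(LINT x:open_cell N c|lborel. f x * (a \<bullet> grad f x)) =
      (LINT x:open_cell N c|lborel. (\<Sum>i\<in>UNIV. a $ i / 2 * grad ?G x $ i))"
    by (intro set_lebesgue_integral_cong) auto
  also have "\<dots> = (\<Sum>i\<in>UNIV. (LINT x:open_cell N c|lborel. a $ i / 2 * grad ?G x $ i))"
    unfolding set_lebesgue_integral_def scaleR_sum_right
    by (rule Bochner_Integration.integral_sum)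
      (use open_cell_integrable[OF tensor_poly_scale[OF grad_tensor_poly[OF G]]] in
        \<open>simp add: set_integrable_def\<close>)
  also have "\<dots> = (\<Sum>i\<in>UNIV. a $ i / 2 * (LINT x:open_cell N c|lborel. grad ?G x $ i))"
    by simp
  finally show ?thesis
    by (simp only: cell_divergence[OF G])
qed

text \<open>Pointwise on the face, \<open>{f} (a \<bullet> [f]) = a\<^sub>i / 2 ((f\<^sup>-)\<^sup>2 - (f\<^sup>+)\<^sup>2)\<close> and the upwind part of the flux, multiplied
  by the jump, is the penalty.  The two squares are integrated separately so that they can be
  matched with the volume terms of the two cells that meet in the face.\<close>

lemma face_term:
  fixes N :: nat and i :: "'d::finite" and c :: "'d \<Rightarrow> nat"
  defines "c' \<equiv> cell_plus N (i, c)"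
  assumes F: "F \<in> tensor_poly" "\<And>x. x \<in> open_cell N c \<Longrightarrow> f x = F x"
    and F': "F' \<in> tensor_poly" "\<And>x. x \<in> open_cell N c' \<Longrightarrow> f x = F' x"
  shows "face_integral N (i, c) (\<lambda>x. upwind_flux a N (i, c) f x \<bullet> jump N (i, c) f x) =
    a $ i / 2 * (slice_integral N i c ((real (c i) + 1) / 2 ^ N) (\<lambda>x. F x * F x) -
      slice_integral N i c' (real (c' i) / 2 ^ N) (\<lambda>x. F' x * F' x)) +
    face_integral N (i, c)
      (\<lambda>x. \<bar>a \<bullet> normal_plus (i, c)\<bar> / 2 * (norm (jump N (i, c) f x))\<^sup>2)"
proof -
  let ?M = "\<Pi>\<^sub>M m\<in>UNIV - {i}. (lborel :: real measure)"
  let ?E = "\<Pi>\<^sub>E m\<in>UNIV - {i}. dyadic_cell N (c m)"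
  let ?x = "\<lambda>y. \<chi> m. if m = i then (real (c i) + 1) / 2 ^ N else y m"
  let ?x' = "\<lambda>y. \<chi> m. if m = i then real (c' i) / 2 ^ N else y m"
  let ?b = "\<bar>a \<bullet> normal_plus (i, c)\<bar> / 2"
  let ?J = "\<lambda>y. F (?x y) - F' (?x' y)"
  have E: "?E \<in> sets ?M"
    by (intro sets_PiM_I_finite) (auto simp: dyadic_cell_def)
  have jump: "jump N (i, c) f (?x y) = ?J y *\<^sub>R axis i 1"
    and ave: "average N (i, c) f (?x y) = (F' (?x' y) + F (?x y)) / 2" if "y \<in> ?E" for y
    using trace_minus_eq[OF F that] trace_plus_eq[OF F'[unfolded c'_def] that, folded c'_def]
    by (simp_all add: jump_def average_def normal_plus_def algebra_simps)
  have n: "(norm (jump N (i, c) f (?x y)))\<^sup>2 = ?J y * ?J y" if "y \<in> ?E" for y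
    using jump[OF that] by (simp add: power2_eq_square)
  have fl: "upwind_flux a N (i, c) f (?x y) \<bullet> jump N (i, c) f (?x y) =
      a $ i / 2 * (F (?x y) * F (?x y)) - a $ i / 2 * (F' (?x' y) * F' (?x' y)) + ?b * (?J y * ?J y)"
    if "y \<in> ?E" for y
    by (simp add: upwind_flux_def jump[OF that] ave[OF that] inner_add_left inner_axis
        power2_eq_square inner_axis' algebra_simps add_divide_distrib diff_divide_distrib)
  \<comment> \<open>The two traces are evaluated at different points \<open>?x y\<close> and \<open>?x' y\<close>; freezing coordinate \<open>i\<close> turns
      their difference into a single polynomial evaluated at \<open>?x y\<close>.\<close>
  have J: "set_integrable ?M ?E (\<lambda>y. ?J y * ?J y)"
  proof -
    have "(\<lambda>x. F (\<chi> m. if m = i then (real (c i) + 1) / 2 ^ N else x $ m) -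
        F' (\<chi> m. if m = i then real (c' i) / 2 ^ N else x $ m)) \<in> tensor_poly" (is "?D \<in> _")
      by (intro tensor_poly_diff tensor_poly_freeze F F')
    then have "set_integrable ?M ?E (\<lambda>y. ?D (?x y) * ?D (?x y))"
      by (intro slice_integrable tensor_poly_mult)
    moreover have "?D (?x y) = ?J y" for y
      by (intro arg_cong2[where f="(-)"] arg_cong[where f=F] arg_cong[where f=F'])
        (auto simp: vec_eq_iff)
    ultimately show ?thesis
      by simp
  qed
  have i1: "set_integrable ?M ?E (\<lambda>y. F (?x y) * F (?x y))"
    by (rule slice_integrable[OF tensor_poly_mult[OF F(1) F(1)]])
  have i2: "set_integrable ?M ?E (\<lambda>y. F' (?x' y) * F' (?x' y))"
    by (rule slice_integrable[OF tensor_poly_mult[OF F'(1) F'(1)]])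
  note i1' = set_integrable_mult_right[where a="a $ i / 2", OF i1]
    and i2' = set_integrable_mult_right[where a="a $ i / 2", OF i2]
    and J' = set_integrable_mult_right[where a="?b", OF J]
  have "face_integral N (i, c) (\<lambda>x. upwind_flux a N (i, c) f x \<bullet> jump N (i, c) f x) =
      (LINT y:?E|?M. a $ i / 2 * (F (?x y) * F (?x y)) - a $ i / 2 * (F' (?x' y) * F' (?x' y)) + ?b * (?J y * ?J y))"
    unfolding face_integral.simps using E fl by (intro set_lebesgue_integral_cong) auto
  also have "\<dots> = a $ i / 2 * (LINT y:?E|?M. F (?x y) * F (?x y)) -
      a $ i / 2 * (LINT y:?E|?M. F' (?x' y) * F' (?x' y)) + (LINT y:?E|?M. ?b * (?J y * ?J y))"
    by (simp only: set_integral_add(2)[OF set_integral_diff(1)[OF i1' i2'] J']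
        set_integral_diff(2)[OF i1' i2'] set_integral_mult_right[where a="a $ i / 2"])
  also have "(LINT y:?E|?M. ?b * (?J y * ?J y)) =
      face_integral N (i, c) (\<lambda>x. ?b * (norm (jump N (i, c) f x))\<^sup>2)"
    unfolding face_integral.simps using E n by (intro set_lebesgue_integral_cong) auto
  also have "(LINT y:?E|?M. F (?x y) * F (?x y)) =
      slice_integral N i c ((real (c i) + 1) / 2 ^ N) (\<lambda>x. F x * F x)"
    by (simp add: slice_integral_def)
  also have "(LINT y:?E|?M. F' (?x' y) * F' (?x' y)) =
      slice_integral N i c' (real (c' i) / 2 ^ N) (\<lambda>x. F' x * F' x)"
  proof -
    have "slice_integral N i c' (real (c' i) / 2 ^ N) (\<lambda>x. F' x * F' x) =
        slice_integral N i c (real (c' i) / 2 ^ N) (\<lambda>x. F' x * F' x)"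
      by (simp add: c'_def slice_integral_upd)
    then show ?thesis
      by (simp add: slice_integral_def)
  qed
  finally show ?thesis
    by (simp add: right_diff_distrib)
qed

lemma cell_plus_bij: "bij_betw (\<lambda>c. cell_plus N (i, c)) (grid_cells N) (grid_cells N)"
proof (rule bij_betw_byWitness)
  \<comment> \<open>Adding \<open>2 ^ N\<close> before subtracting \<open>1\<close> avoids truncated subtraction at index \<open>0\<close>.\<close>
  let ?g = "\<lambda>c. c(i := (c i + 2 ^ N - 1) mod 2 ^ N)"
  show "\<forall>c\<in>grid_cells N. ?g (cell_plus N (i, c)) = c"
  proof
    fix c :: "'a \<Rightarrow> nat" assume "c \<in> grid_cells N"
    then have "c i < 2 ^ N" by (simp add: grid_cells_def)
    then have "((c i + 1) mod 2 ^ N + 2 ^ N - 1) mod 2 ^ N = c i"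
      by (cases "c i + 1 = 2 ^ N") auto
    then show "?g (cell_plus N (i, c)) = c" by simp
  qed
  show "\<forall>c\<in>grid_cells N. cell_plus N (i, ?g c) = c"
  proof
    fix c :: "'a \<Rightarrow> nat" assume "c \<in> grid_cells N"
    then have "c i < 2 ^ N" by (simp add: grid_cells_def)
    then have "((c i + 2 ^ N - 1) mod 2 ^ N + 1) mod 2 ^ N = c i"
      by (simp add: mod_Suc_eq)
    then show "cell_plus N (i, ?g c) = c" by simp
  qed
  show "(\<lambda>c. cell_plus N (i, c)) ` grid_cells N \<subseteq> grid_cells N"
    by (auto simp: grid_cells_def)
  show "?g ` grid_cells N \<subseteq> grid_cells N"
    by (auto simp: grid_cells_def)
qed

text \<open>Cell by cell, the volume terms are differences between upper and lower faces; face by face, the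
  averaged flux gives differences between a cell's upper face and its neighbour's lower face.
  Summing over all cells, the two agree because passing to the periodic neighbour permutes the cells.\<close>

lemma upwind_energy_identity:
  fixes f :: "real ^ 'd::finite \<Rightarrow> real"
  assumes "\<And>c. c \<in> grid_cells N \<Longrightarrow> \<exists>F\<in>tensor_poly. \<forall>x\<in>open_cell N c. f x = F x"
  shows "(\<Sum>c\<in>grid_cells N. LINT x:open_cell N c|lborel. f x * (a \<bullet> grad f x)) -
      (\<Sum>e\<in>faces N. face_integral N e (\<lambda>x. upwind_flux a N e f x \<bullet> jump N e f x)) =
    - (\<Sum>e\<in>faces N. face_integral N e
        (\<lambda>x. \<bar>a \<bullet> normal_plus e\<bar> / 2 * (norm (jump N e f x))\<^sup>2))"
proof -
  obtain F where F: "\<And>c. c \<in> grid_cells N \<Longrightarrow> F c \<in> tensor_poly"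
      "\<And>c x. c \<in> grid_cells N \<Longrightarrow> x \<in> open_cell N c \<Longrightarrow> f x = F c x"
    using assms by metis
  define up where "up = (\<lambda>i c. slice_integral N i c ((real (c i) + 1) / 2 ^ N) (\<lambda>x. F c x * F c x))"
  define low where "low = (\<lambda>i c. slice_integral N i c (real (c i) / 2 ^ N) (\<lambda>x. F c x * F c x))"
  let ?S = "\<lambda>e. face_integral N e (\<lambda>x. \<bar>a \<bullet> normal_plus e\<bar> / 2 * (norm (jump N e f x))\<^sup>2)"
  let ?p = "\<lambda>i c. cell_plus N (i, c)"
  have p: "?p i c \<in> grid_cells N" if "c \<in> grid_cells N" for i and c :: "'d \<Rightarrow> nat"
    using bij_betwE[OF cell_plus_bij[of N i]] that by blast
  have re: "(\<Sum>c\<in>grid_cells N. low i (?p i c)) = (\<Sum>c\<in>grid_cells N. low i c)" for i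
    by (rule sum.reindex_bij_betw[OF cell_plus_bij])
  have "(\<Sum>c\<in>grid_cells N. LINT x:open_cell N c|lborel. f x * (a \<bullet> grad f x)) =
      (\<Sum>c\<in>grid_cells N. \<Sum>i\<in>UNIV. a $ i / 2 * (up i c - low i c))"
    unfolding up_def low_def by (intro sum.cong refl volume_term F)
  also have "\<dots> = (\<Sum>i\<in>UNIV. a $ i / 2 * ((\<Sum>c\<in>grid_cells N. up i c) - (\<Sum>c\<in>grid_cells N. low i c)))"
    by (subst sum.swap) (simp add: sum_distrib_left sum_subtractf right_diff_distrib)
  also have "\<dots> = (\<Sum>i\<in>UNIV. a $ i / 2 * ((\<Sum>c\<in>grid_cells N. up i c) - (\<Sum>c\<in>grid_cells N. low i (?p i c))))"
    by (simp only: re)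
  also have "\<dots> = (\<Sum>i\<in>UNIV. \<Sum>c\<in>grid_cells N. a $ i / 2 * (up i c - low i (?p i c)))"
    by (simp add: sum_distrib_left sum_subtractf right_diff_distrib)
  finally have vol: "(\<Sum>c\<in>grid_cells N. LINT x:open_cell N c|lborel. f x * (a \<bullet> grad f x)) =
      (\<Sum>i\<in>UNIV. \<Sum>c\<in>grid_cells N. a $ i / 2 * (up i c - low i (?p i c)))" .
  have "(\<Sum>e\<in>faces N. face_integral N e (\<lambda>x. upwind_flux a N e f x \<bullet> jump N e f x)) =
      (\<Sum>i\<in>UNIV. \<Sum>c\<in>grid_cells N. face_integral N (i, c) (\<lambda>x. upwind_flux a N (i, c) f x \<bullet> jump N (i, c) f x))"
    unfolding faces_def by (subst sum.cartesian_product) (simp add: split_beta del: face_integral.simps)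
  also have "\<dots> = (\<Sum>i\<in>UNIV. \<Sum>c\<in>grid_cells N. a $ i / 2 * (up i c - low i (?p i c)) + ?S (i, c))"
    unfolding up_def low_def by (intro sum.cong refl face_term F p)
  also have "\<dots> = (\<Sum>i\<in>UNIV. \<Sum>c\<in>grid_cells N. a $ i / 2 * (up i c - low i (?p i c))) + (\<Sum>e\<in>faces N. ?S e)"
    unfolding faces_def by (simp add: sum.distrib sum.cartesian_product split_beta del: face_integral.simps)
  finally show ?thesis
    unfolding vol by simp
qed

section \<open>Nodal interpolation in the sparse space\<close>

lemma lagrange_interpolation:
  fixes A :: "real set"
  assumes "finite A"
  obtains L where "\<And>p x. degree p < card A \<Longrightarrow> poly p x = (\<Sum>a\<in>A. poly p a * poly (L a) x)"
proof
  define L where "L = (\<lambda>a. smult (1 / (\<Prod>b\<in>A - {a}. a - b)) (\<Prod>b\<in>A - {a}. [:- b, 1:]))"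
  have deg: "degree (L a) < card A" if "a \<in> A" for a
  proof -
    have "degree (L a) \<le> degree (\<Prod>b\<in>A - {a}. [:- b, 1:])"
      unfolding L_def by (rule degree_smult_le)
    also have "\<dots> \<le> (\<Sum>b\<in>A - {a}. degree [:- b, 1:])"
      using degree_prod_sum_le[of "A - {a}" "\<lambda>b. [:- b, 1:]"] assms by (simp add: comp_def)
    also have "\<dots> = card (A - {a})"
      by simp
    also have "\<dots> < card A"
      using assms that by (rule card_Diff1_less)
    finally show ?thesis .
  qed
  have delta: "poly (L a) y = of_bool (a = y)" if "y \<in> A" for a y
    using assms that by (auto simp: L_def poly_prod prod_zero_iff)
  show "poly p x = (\<Sum>a\<in>A. poly p a * poly (L a) x)" if p: "degree p < card A" for p x
  proof -
    have "p = (\<Sum>a\<in>A. smult (poly p a) (L a))"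
    proof (rule poly_eqI_degree[where A=A])
      show "poly p y = poly (\<Sum>a\<in>A. smult (poly p a) (L a)) y" if "y \<in> A" for y
        using assms that by (simp add: poly_sum delta)
      show "degree (\<Sum>a\<in>A. smult (poly p a) (L a)) < card A"
        using p by (intro degree_sum_less le_less_trans[OF degree_smult_le] deg) auto
    qed (fact p)
    then have "poly p x = poly (\<Sum>a\<in>A. smult (poly p a) (L a)) x"
      by simp
    then show ?thesis
      by (simp add: poly_sum)
  qed
qed

lemma mem_dyadic_cell_iff: "x \<in> dyadic_cell n j \<longleftrightarrow> \<lceil>x * 2 ^ n\<rceil> = int j + 1"
  by (simp add: dyadic_cell_def ceiling_eq_iff pos_divide_less_eq pos_le_divide_eq)

text \<open>Choosing \<open>k + 1\<close> nodes inside every dyadic cell and interpolating by Lagrange polynomials on each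
  cell reproduces piecewise polynomials of degree at most \<open>k\<close> at every point of the real line.
  Exactly one cell contains a given point of \<open>{0<..1}\<close>, so only that cell contributes.\<close>

lemma dg_V_nodal:
  obtains A :: "nat \<Rightarrow> real set" and L :: "nat \<Rightarrow> real \<Rightarrow> real poly"
  where "\<And>j. finite (A j)"
    and "\<And>f x. f \<in> dg_V k N \<Longrightarrow>
      f x = (\<Sum>(j, a)\<in>Sigma {..<2 ^ N} A. f a * (indicator (dyadic_cell N j) x * poly (L j a) x))"
proof -
  have "\<exists>A. finite A \<and> card A = Suc k \<and> A \<subseteq> dyadic_cell N j" for j
    by (rule infinite_arbitrarily_large) (simp add: dyadic_cell_def divide_strict_right_mono)
  then obtain A where A: "\<And>j. finite (A j)" "\<And>j. card (A j) = Suc k" "\<And>j. A j \<subseteq> dyadic_cell N j"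
    by metis
  have "\<exists>L. \<forall>p x. degree p \<le> k \<longrightarrow> poly p x = (\<Sum>a\<in>A j. poly p a * poly (L a) x)" for j
    using lagrange_interpolation[OF A(1), of j] A(2)[of j] by (metis less_Suc_eq_le)
  then obtain L where L: "\<And>j p x. degree p \<le> k \<Longrightarrow> poly p x = (\<Sum>a\<in>A j. poly p a * poly (L j a) x)"
    by metis
  show thesis
  proof (rule that[OF A(1)])
    fix f x assume f: "f \<in> dg_V k N"
    let ?I = "\<lambda>j. \<Sum>a\<in>A j. f a * (indicator (dyadic_cell N j) x * poly (L j a) x)"
    have "(\<Sum>(j, a)\<in>Sigma {..<2 ^ N} A. f a * (indicator (dyadic_cell N j) x * poly (L j a) x)) =
        (\<Sum>j<2 ^ N. ?I j)"
      by (rule sum.Sigma[symmetric]) (simp_all add: A)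
    also have "\<dots> = f x"
    proof (cases "x \<in> {0<..1}")
      case False
      have "?I j = 0" if "j < 2 ^ N" for j
      proof -
        have "real j + 1 \<le> 2 ^ N"
          using that by (metis Suc_leI of_nat_Suc of_nat_le_iff of_nat_numeral of_nat_power add.commute)
        have "x \<notin> dyadic_cell N j"
        proof
          assume "x \<in> dyadic_cell N j"
          then have "real j < x * 2 ^ N" "x * 2 ^ N \<le> real j + 1"
            by (simp_all add: dyadic_cell_def pos_divide_less_eq pos_le_divide_eq)
          with \<open>real j + 1 \<le> 2 ^ N\<close> have "0 < x * 2 ^ N" "x * 2 ^ N \<le> 1 * 2 ^ N"
            by linarith+
          then have "0 < x" "x \<le> 1"
            by (simp_all add: zero_less_mult_iff)
          with False show False
            by simp
        qed
        then show ?thesis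
          by simp
      qed
      moreover have "f x = 0"
        using f False unfolding dg_V_def by blast
      ultimately show ?thesis
        by simp
    next
      case True
      \<comment> \<open>The cells are half-open on the left, so the index of the cell of \<open>x\<close> is the ceiling minus one.\<close>
      define i where "i = nat (\<lceil>x * 2 ^ N\<rceil> - 1)"
      have "0 < x * 2 ^ N" "x * 2 ^ N \<le> 2 ^ N"
        using True by auto
      then have "0 < \<lceil>x * 2 ^ N\<rceil>" "\<lceil>x * 2 ^ N\<rceil> \<le> 2 ^ N"
        by (simp_all add: ceiling_le_iff)
      then have i: "int i + 1 = \<lceil>x * 2 ^ N\<rceil>" "i < 2 ^ N"
        by (simp_all add: i_def nat_less_iff)
      then have x: "x \<in> dyadic_cell N j \<longleftrightarrow> j = i" for j
        by (auto simp: mem_dyadic_cell_iff)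
      obtain p where p: "degree p \<le> k" "\<And>y. y \<in> dyadic_cell N i \<Longrightarrow> f y = poly p y"
        using f i(2) unfolding dg_V_def by blast
      have "(\<Sum>j<2 ^ N. ?I j) = (\<Sum>j<2 ^ N. if j = i then ?I i else 0)"
        by (rule sum.cong) (simp_all add: x indicator_def)
      also have "\<dots> = ?I i"
        using i(2) by simp
      also have "\<dots> = (\<Sum>a\<in>A i. poly p a * poly (L i a) x)"
        using A(3) by (intro sum.cong) (auto simp: x p(2) subset_iff)
      also have "\<dots> = f x"
        using L[OF p(1)] p(2) x by simp
      finally show ?thesis .
    qed
    finally show "f x = (\<Sum>(j, a)\<in>Sigma {..<2 ^ N} A. f a * (indicator (dyadic_cell N j) x * poly (L j a) x))"
      by simp
  qed
qed

lemma dyadic_cell_nested: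
  assumes "n \<le> N"
  shows "dyadic_cell N j \<subseteq> dyadic_cell n (j div 2 ^ (N - n))"
proof -
  define q where "q = j div 2 ^ (N - n)"
  have N: "(2::real) ^ N = 2 ^ n * 2 ^ (N - n)"
    using assms by (simp flip: power_add)
  have "q * 2 ^ (N - n) \<le> j" "j + 1 \<le> (q + 1) * 2 ^ (N - n)"
    using div_less_iff_less_mult[of "2 ^ (N - n)" j "q + 1"] by (simp_all add: q_def)
  then have "real (q * 2 ^ (N - n)) \<le> real j" "real (j + 1) \<le> real ((q + 1) * 2 ^ (N - n))"
    by (simp_all only: of_nat_le_iff)
  then have "real q * 2 ^ (N - n) \<le> real j" "real j + 1 \<le> (real q + 1) * 2 ^ (N - n)"
    by (simp_all add: distrib_right)
  then have "(real q * 2 ^ (N - n)) / (2 ^ n * 2 ^ (N - n)) \<le> real j / 2 ^ N"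
    and "(real j + 1) / 2 ^ N \<le> ((real q + 1) * 2 ^ (N - n)) / (2 ^ n * 2 ^ (N - n))"
    unfolding N by (intro divide_right_mono; simp)+
  then have "real q / 2 ^ n \<le> real j / 2 ^ N" "(real j + 1) / 2 ^ N \<le> (real q + 1) / 2 ^ n"
    by simp_all
  then show ?thesis
    unfolding dyadic_cell_def q_def[symmetric]
    by (intro Ioc_subset_iff[THEN iffD2] disjI2 conjI)
qed

lemma dg_V_mono:
  assumes "n \<le> N"
  shows "dg_V k n \<subseteq> dg_V k N"
proof
  fix f assume f: "f \<in> dg_V k n"
  have "\<exists>p. degree p \<le> k \<and> (\<forall>x\<in>dyadic_cell N j. f x = poly p x)" if "j < 2 ^ N" for j
  proof -
    have "j div 2 ^ (N - n) < 2 ^ n"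
      using that assms by (simp add: div_less_iff_less_mult flip: power_add)
    then show ?thesis
      using f dyadic_cell_nested[OF assms, of j] unfolding dg_V_def by blast
  qed
  with f show "f \<in> dg_V k N"
    unfolding dg_V_def by blast
qed

lemma dg_W_subset: "dg_W k n \<subseteq> dg_V k n"
  by (cases n) auto

text \<open>The dyadic partitions are nested, so every factor of level at most \<open>N\<close> is also piecewise polynomial
  on level \<open>N\<close>.  Hence the sparse space lies in the full tensor-product space.\<close>

lemma sparse_V_subset_tensor:
  "sparse_V k N \<subseteq> fun_vs.span {(\<lambda>x::real ^ 'd::finite. \<Prod>m\<in>UNIV. \<phi> m (x $ m)) | \<phi>. \<forall>m. \<phi> m \<in> dg_V k N}"
    (is "_ \<subseteq> fun_vs.span ?B")
proof -
  have "tensor_W k l \<subseteq> fun_vs.span ?B" if "(\<Sum>m\<in>UNIV. l m) \<le> N" for l :: "'d \<Rightarrow> nat"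
  proof -
    have "l m \<le> N" for m
      using that member_le_sum[of m UNIV l] by simp
    then have "dg_W k (l m) \<subseteq> dg_V k N" for m
      using dg_W_subset dg_V_mono by blast
    then show ?thesis
      unfolding tensor_W_def by (intro fun_vs.span_mono) blast
  qed
  then show ?thesis
    unfolding sparse_V_def by (intro fun_vs.span_minimal fun_vs.subspace_span) blast
qed

text \<open>A property that is closed under linear combinations and holds for the products spanning
  the full tensor-product space holds on the sparse space.  The induction runs over the larger
  space, whose generators are products without orthogonality conditions.\<close>

lemma sparse_V_induct [consumes 1, case_names zero add scale prod]:
  fixes f :: "real ^ 'd::finite \<Rightarrow> real"
  assumes "f \<in> sparse_V k N"
    and "P (\<lambda>x. 0)"
    and "\<And>f g. P f \<Longrightarrow> P g \<Longrightarrow> P (\<lambda>x. f x + g x)"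
    and "\<And>c f. P f \<Longrightarrow> P (\<lambda>x. c * f x)"
    and "\<And>\<phi>. (\<And>m. \<phi> m \<in> dg_V k N) \<Longrightarrow> P (\<lambda>x. \<Prod>m\<in>UNIV. \<phi> m (x $ m))"
  shows "P f"
  using subsetD[OF sparse_V_subset_tensor assms(1)]
proof (rule fun_vs.span_induct)
  show "fun_vs.subspace (Collect P)"
    using assms(2-4) by (simp add: fun_vs.subspace_def zero_fun_def plus_fun_def)
qed (use assms(5) in auto)

lemma sparse_V_tensor_poly:
  fixes f :: "real ^ 'd::finite \<Rightarrow> real"
  assumes "f \<in> sparse_V k N" and c: "c \<in> grid_cells N"
  shows "\<exists>F\<in>tensor_poly. \<forall>x\<in>open_cell N c. f x = F x"
  using assms(1)
proof (induction rule: sparse_V_induct)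
  case zero
  show ?case by (intro bexI[OF _ tensor_poly_0]) simp
next
  case (add f g)
  then obtain F G where "F \<in> tensor_poly" "G \<in> tensor_poly"
      "\<forall>x\<in>open_cell N c. f x = F x" "\<forall>x\<in>open_cell N c. g x = G x"
    by blast
  then show ?case
    by (intro bexI[OF _ tensor_poly_add[of F G]]) auto
next
  case (scale b f)
  then obtain F where "F \<in> tensor_poly" "\<forall>x\<in>open_cell N c. f x = F x"
    by blast
  then show ?case
    by (intro bexI[OF _ tensor_poly_scale[of F b]]) auto
next
  case (prod \<phi>)
  have "\<exists>p. \<forall>x\<in>dyadic_cell N (c m). \<phi> m x = poly p x" for m
    using prod[of m] c unfolding dg_V_def grid_cells_def by blast
  then obtain p where p: "\<And>m x. x \<in> dyadic_cell N (c m) \<Longrightarrow> \<phi> m x = poly (p m) x"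
    by metis
  have "x $ m \<in> dyadic_cell N (c m)" if "x \<in> open_cell N c" for x m
    using that by (simp add: open_cell_def mem_box_cart dyadic_cell_def less_imp_le)
  then show ?case
    by (intro bexI[OF _ tensor_poly_prod[of p]]) (simp add: p)
qed

text \<open>A product of one-dimensional interpolation formulas is an interpolation formula on the product
  grid, by expanding the product of sums; linearity extends it from products to the whole space.
  An index \<open>s\<close> picks a cell and a node in it for each coordinate.\<close>

lemma sparse_V_nodal:
  obtains S :: "('d::finite \<Rightarrow> nat \<times> real) set" and z :: "('d \<Rightarrow> nat \<times> real) \<Rightarrow> real ^ 'd"
    and L :: "('d \<Rightarrow> nat \<times> real) \<Rightarrow> real ^ 'd \<Rightarrow> real"
  where "finite S"
    and "\<And>r s. set_integrable lborel (cbox 0 1) (\<lambda>x. L r x * L s x)"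
    and "\<And>f x. f \<in> sparse_V k N \<Longrightarrow> f x = (\<Sum>s\<in>S. f (z s) * L s x)"
proof -
  obtain A :: "nat \<Rightarrow> real set" and L :: "nat \<Rightarrow> real \<Rightarrow> real poly"
    where A: "\<And>j. finite (A j)"
      and nodal: "\<And>f x. f \<in> dg_V k N \<Longrightarrow>
        f x = (\<Sum>(j, a)\<in>Sigma {..<2 ^ N} A. f a * (indicator (dyadic_cell N j) x * poly (L j a) x))"
    using dg_V_nodal by blast
  let ?Q = "Sigma {..<2 ^ N} A"
  define \<beta> where "\<beta> = (\<lambda>q t. indicator (dyadic_cell N (fst q)) t * poly (L (fst q) (snd q)) t)"
  let ?S = "\<Pi>\<^sub>E m\<in>(UNIV :: 'd set). ?Q"
  let ?z = "\<lambda>s::'d \<Rightarrow> nat \<times> real. \<chi> m. snd (s m)"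
  let ?L = "\<lambda>s (x::real ^ 'd). \<Prod>m\<in>UNIV. \<beta> (s m) (x $ m)"
  have Q: "finite ?Q"
    by (simp add: A)
  show thesis
  proof (rule that)
    show "finite ?S"
      by (intro finite_PiE Q) auto
  next
    fix r s :: "'d \<Rightarrow> nat \<times> real"
    have h: "integrable lborel (\<lambda>t. \<beta> (r m) t * \<beta> (s m) t)" for m
    proof -
      let ?p = "L (fst (r m)) (snd (r m)) * L (fst (s m)) (snd (s m))"
      have "integrable lborel (\<lambda>t. indicator (dyadic_cell N (fst (s m))) t * poly ?p t)"
        by (rule poly_integrable_interval) (auto simp: dyadic_cell_def intro: less_imp_le)
      then have "integrable lborel (\<lambda>t. indicator (dyadic_cell N (fst (r m))) t *\<^sub>R
          (indicator (dyadic_cell N (fst (s m))) t * poly ?p t))"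
        by (intro integrable_mult_indicator) (simp_all add: dyadic_cell_def)
      then show ?thesis
        by (simp add: \<beta>_def mult_ac)
    qed
    have "integrable lborel (\<lambda>x. \<Prod>m\<in>UNIV. \<beta> (r m) (x $ m) * \<beta> (s m) (x $ m))"
      by (rule lborel_prod_components(1)[OF h])
    then show "set_integrable lborel (cbox 0 1) (\<lambda>x. ?L r x * ?L s x)"
      unfolding set_integrable_def prod.distrib by (intro integrable_mult_indicator) simp_all
  next
    fix f :: "real ^ 'd \<Rightarrow> real" and x
    assume "f \<in> sparse_V k N"
    then show "f x = (\<Sum>s\<in>?S. f (?z s) * ?L s x)"
    proof (induction rule: sparse_V_induct)
      case zero
      show ?case by simp
    next
      case (add f g)
      then show ?case by (simp add: distrib_right sum.distrib)
    next
      case (scale c f)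
      then show ?case by (simp add: mult.assoc flip: sum_distrib_left)
    next
      case (prod \<phi>)
      have "(\<Prod>m\<in>UNIV. \<phi> m (x $ m)) = (\<Prod>m\<in>UNIV. \<Sum>q\<in>?Q. \<phi> m (snd q) * \<beta> q (x $ m))"
        by (intro prod.cong refl, subst nodal[OF prod]) (simp add: \<beta>_def split_beta)
      also have "\<dots> = (\<Sum>s\<in>?S. \<Prod>m\<in>UNIV. \<phi> m (snd (s m)) * \<beta> (s m) (x $ m))"
        by (rule prod_sum_PiE) (simp_all add: Q)
      finally show ?case
        by (simp add: prod.distrib)
    qed
  qed
qed

section \<open>The energy balance\<close>

text \<open>Interpolation expresses the energy as \<open>\<Sum>\<^sub>r \<Sum>\<^sub>s M\<^sub>r\<^sub>s u(z\<^sub>r) u(z\<^sub>s)\<close> with a constant symmetric mass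
  matrix \<open>M\<close>, which is differentiated by the product rule.  To recognise the result as
  \<open>2 \<integral> u\<^sub>t u\<close> one needs that \<open>u\<^sub>t\<close> obeys the same interpolation formula; this follows by differentiating
  the formula for \<open>u\<close> and uniqueness of derivatives, for which \<open>t\<close> must not be isolated in \<open>J\<close>.\<close>

lemma energy_has_derivative:
  fixes u :: "real \<Rightarrow> real ^ 'd::finite \<Rightarrow> real"
  assumes u: "\<And>\<tau>. \<tau> \<in> J \<Longrightarrow> u \<tau> \<in> sparse_V k N"
    and ut: "\<And>x. ((\<lambda>s. u s x) has_real_derivative ut x) (at t within J)"
    and t: "t \<in> J" "t islimpt J"
  shows "((\<lambda>s. LINT x:cbox 0 1|lborel. (u s x)\<^sup>2) has_real_derivative
    2 * (LINT x:cbox 0 1|lborel. ut x * u t x)) (at t within J)"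
proof -
  obtain S :: "('d \<Rightarrow> nat \<times> real) set" and z L
    where S: "finite S"
      and int: "\<And>r s. set_integrable lborel (cbox 0 1) (\<lambda>x::real ^ 'd. L r x * L s x)"
      and nodal: "\<And>f x. f \<in> sparse_V k N \<Longrightarrow> f x = (\<Sum>s\<in>S. f (z s) * L s x)"
    by (rule sparse_V_nodal[where k=k and N=N]) blast
  define M where "M = (\<lambda>r s. LINT x:cbox 0 1|lborel. L r x * L s x)"
  have M_commute: "M r s = M s r" for r s
    by (simp add: M_def mult.commute)
  have bilinear: "(LINT x:cbox 0 1|lborel. (\<Sum>r\<in>S. \<alpha> r * L r x) * (\<Sum>s\<in>S. \<beta> s * L s x)) =
      (\<Sum>r\<in>S. \<Sum>s\<in>S. \<alpha> r * \<beta> s * M r s)" for \<alpha> \<beta> :: "('d \<Rightarrow> nat \<times> real) \<Rightarrow> real"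
  proof -
    have *: "integrable lborel (\<lambda>x. \<alpha> r * \<beta> s * (indicator (cbox 0 1) x *\<^sub>R (L r x * L s x)))" for r s
      using int[of r s] unfolding set_integrable_def by (rule integrable_mult_right)
    have "(LINT x:cbox 0 1|lborel. (\<Sum>r\<in>S. \<alpha> r * L r x) * (\<Sum>s\<in>S. \<beta> s * L s x)) =
        (LINT x|lborel. (\<Sum>r\<in>S. \<Sum>s\<in>S. \<alpha> r * \<beta> s * (indicator (cbox 0 1) x *\<^sub>R (L r x * L s x))))"
      unfolding set_lebesgue_integral_def sum_product
      unfolding real_scaleR_def sum_distrib_left
      by (intro Bochner_Integration.integral_cong sum.cong refl) (simp only: mult_ac)
    also have "\<dots> = (\<Sum>r\<in>S. \<Sum>s\<in>S. (LINT x|lborel. \<alpha> r * \<beta> s * (indicator (cbox 0 1) x *\<^sub>R (L r x * L s x))))"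
      by (subst Bochner_Integration.integral_sum, intro Bochner_Integration.integrable_sum *)
        (intro sum.cong refl Bochner_Integration.integral_sum *)
    finally show ?thesis
      by (simp only: integral_mult_right_zero M_def set_lebesgue_integral_def)
  qed
  have nb: "at t within J \<noteq> bot"
    using t(2) by (simp add: trivial_limit_within)
  have ut_nodal: "ut x = (\<Sum>s\<in>S. ut (z s) * L s x)" for x
  proof (rule has_field_derivative_unique[OF ut _ nb])
    have "((\<lambda>\<tau>. \<Sum>s\<in>S. u \<tau> (z s) * L s x) has_real_derivative (\<Sum>s\<in>S. ut (z s) * L s x)) (at t within J)"
      by (intro DERIV_sum DERIV_cmult_right ut)
    then show "((\<lambda>\<tau>. u \<tau> x) has_real_derivative (\<Sum>s\<in>S. ut (z s) * L s x)) (at t within J)"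
      by (rule has_field_derivative_transform_within[OF _ zero_less_one t(1)])
        (rule nodal[OF u, symmetric])
  qed
  have "((\<lambda>\<tau>. \<Sum>r\<in>S. \<Sum>s\<in>S. u \<tau> (z r) * u \<tau> (z s) * M r s) has_real_derivative
      (\<Sum>r\<in>S. \<Sum>s\<in>S. (ut (z r) * u t (z s) + ut (z s) * u t (z r)) * M r s)) (at t within J)"
    by (intro DERIV_sum DERIV_cmult_right DERIV_mult ut)
  moreover have "(\<Sum>r\<in>S. \<Sum>s\<in>S. (ut (z r) * u t (z s) + ut (z s) * u t (z r)) * M r s) =
      2 * (LINT x:cbox 0 1|lborel. ut x * u t x)"
  proof -
    have "(LINT x:cbox 0 1|lborel. ut x * u t x) =
        (LINT x:cbox 0 1|lborel. (\<Sum>r\<in>S. ut (z r) * L r x) * (\<Sum>s\<in>S. u t (z s) * L s x))"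
      unfolding ut_nodal[symmetric] nodal[OF u[OF t(1)], symmetric] ..
    also have "\<dots> = (\<Sum>r\<in>S. \<Sum>s\<in>S. ut (z r) * u t (z s) * M r s)" (is "_ = ?D")
      by (rule bilinear)
    finally have D: "(LINT x:cbox 0 1|lborel. ut x * u t x) = ?D" .
    have "(\<Sum>r\<in>S. \<Sum>s\<in>S. ut (z s) * u t (z r) * M r s) = ?D"
      by (subst sum.swap) (intro sum.cong refl arg_cong2[where f="(*)"] M_commute)
    then show ?thesis
      by (simp add: D distrib_right sum.distrib)
  qed
  ultimately have "((\<lambda>\<tau>. \<Sum>r\<in>S. \<Sum>s\<in>S. u \<tau> (z r) * u \<tau> (z s) * M r s) has_real_derivative
      2 * (LINT x:cbox 0 1|lborel. ut x * u t x)) (at t within J)"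
    by simp
  then show ?thesis
  proof (rule has_field_derivative_transform_within[OF _ zero_less_one t(1)])
    fix \<tau> assume "\<tau> \<in> J"
    show "(\<Sum>r\<in>S. \<Sum>s\<in>S. u \<tau> (z r) * u \<tau> (z s) * M r s) = (LINT x:cbox 0 1|lborel. (u \<tau> x)\<^sup>2)"
      unfolding bilinear[symmetric] nodal[OF u[OF \<open>\<tau> \<in> J\<close>], symmetric] power2_eq_square ..
  qed
qed

lemma face_integral_nonneg:
  assumes "\<And>x. 0 \<le> g x"
  shows "0 \<le> face_integral N e g"
  by (cases e) (simp add: set_lebesgue_integral_def assms integral_nonneg_AE)

theorem theorem3p1:
  fixes a :: "real ^ 'd::finite" and k N :: nat
    and J :: "real set" and u :: "real \<Rightarrow> real ^ 'd \<Rightarrow> real" and t :: real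
  assumes "is_interval J" and "interior J \<noteq> {}"
    and "sparse_dg_solution a k N J u"
    and "t \<in> J"
  shows "\<exists>D. ((\<lambda>s. LINT x:cbox 0 1|lborel. (u s x)\<^sup>2) has_real_derivative D) (at t within J) \<and>
      1 / 2 * D = - (\<Sum>e\<in>faces N. face_integral N e
                      (\<lambda>x. \<bar>a \<bullet> normal_plus e\<bar> / 2 * (norm (jump N e (u t) x))\<^sup>2)) \<and>
      - (\<Sum>e\<in>faces N. face_integral N e
           (\<lambda>x. \<bar>a \<bullet> normal_plus e\<bar> / 2 * (norm (jump N e (u t) x))\<^sup>2)) \<le> 0"
proof -
  obtain ut where u: "\<And>\<tau>. \<tau> \<in> J \<Longrightarrow> u \<tau> \<in> sparse_V k N"
    and ut: "\<And>x. ((\<lambda>s. u s x) has_real_derivative ut t x) (at t within J)"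
    and scheme: "\<And>v. v \<in> sparse_V k N \<Longrightarrow>
        (LINT x:cbox 0 1|lborel. ut t x * v x) =
        (\<Sum>c\<in>grid_cells N. LINT x:open_cell N c|lborel. u t x * (a \<bullet> grad v x)) -
        (\<Sum>e\<in>faces N. face_integral N e (\<lambda>x. upwind_flux a N e (u t) x \<bullet> jump N e v x))"
    using assms(3,4) unfolding sparse_dg_solution_def by blast
  have "J \<noteq> {x}" for x
    using assms(2) by auto
  then have lim: "t islimpt J"
    using assms(1,4) by (intro connected_imp_perfect is_interval_connected)
  let ?D = "LINT x:cbox 0 1|lborel. ut t x * u t x"
  have "?D = - (\<Sum>e\<in>faces N. face_integral N e
      (\<lambda>x. \<bar>a \<bullet> normal_plus e\<bar> / 2 * (norm (jump N e (u t) x))\<^sup>2))"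
    unfolding scheme[OF u[OF assms(4)]]
    by (rule upwind_energy_identity) (rule sparse_V_tensor_poly[OF u[OF assms(4)]])
  moreover have "0 \<le> (\<Sum>e\<in>faces N. face_integral N e
      (\<lambda>x. \<bar>a \<bullet> normal_plus e\<bar> / 2 * (norm (jump N e (u t) x))\<^sup>2))"
    by (intro sum_nonneg face_integral_nonneg) simp
  ultimately show ?thesis
    using energy_has_derivative[OF u ut assms(4) lim] by (intro exI[of _ "2 * ?D"]) simp
qed

end
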